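(* Let $G$ be a simple connected graph with $n\geq 3$ vertices and $m$ edges. Let $\delta$ and $\Delta$ denote the minimum and maximum edge neighborhood degrees of $G$, respectively, where $\delta\neq\Delta$. Let $M_1=M_1(G)$, let $a\in\mathbb{R}\setminus\{0,1\}$ and set $s_a=\frac{\Delta^a-\delta^a}{\Delta-\delta}$. Then the following statements hold. (1) If $a<0$ or $a>1$, then $KB^a(G)\leq n\delta^a+(2M_1-4m-n\delta)s_a$. (2) If $0<a<1$, then $KB^a(G)\geq n\delta^a+(2M_1-4m-n\delta)s_a$. (3) If $a>1$, then \[\ln\left[\prod_{v\in V(G)}S_e(v)^a\right]\geq a\left[n\ln\delta+\frac{(2M_1-4m-n\delta)(\ln\Delta-\ln\delta)}{\Delta-\delta}\right].\] In all three parts, equality holds if every vertex of $G$ has edge neighborhood degree $\delta$ or $\Delta$.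
   Context: Graphs are finite. For a simple graph $G$ with vertex set $V(G)$ and edge set $E(G)$, $d(u)$ denotes the degree of a vertex $u$. The degree of an edge $e=uv$ is $d_G(e)=d(u)+d(v)-2$. The edge neighborhood degree $S_e(v)$ of a vertex $v$ is the sum of the degrees $d_G(e)$ of all edges $e$ incident to $v$. The first Zagreb index is $M_1(G)=\sum_{u\in V(G)}d(u)^2$. For real $a\neq 0,1$, the general Kulli-Basava index is $KB^a(G)=\sum_{v\in V(G)}S_e(v)^a$, and the general multiplicative Kulli-Basava index is $\prod_{v\in V(G)}S_e(v)^a$. *)

theory Defs
  imports Complex_Main "Graph_Theory.Digraph_Component"
begin

text \<open>
  A finite simple graph is a \<^locale>\<open>pair_graph\<close>: finite, loop-free and symmetric, without
  parallel arcs. There each undirected edge is a pair of opposite arcs, so edges are taken to be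
  the two-element sets of endpoints; every edge is then counted once.
\<close>

definition edges :: "'a pair_pre_digraph \<Rightarrow> 'a set set" where
  "edges G = (\<lambda>(u, v). {u, v}) ` parcs G"

definition vertex_degree :: "'a pair_pre_digraph \<Rightarrow> 'a \<Rightarrow> nat" where
  "vertex_degree G u = card {e \<in> edges G. u \<in> e}"

text \<open>For an edge \<open>e = {u, v}\<close> this is \<open>d(u) + d(v) - 2\<close>. It is real-valued, so the
  subtraction is not truncated.\<close>

definition edge_degree :: "'a pair_pre_digraph \<Rightarrow> 'a set \<Rightarrow> real" where
  "edge_degree G e = (\<Sum>u\<in>e. real (vertex_degree G u)) - 2"

definition edge_nbhd_degree :: "'a pair_pre_digraph \<Rightarrow> 'a \<Rightarrow> real" where
  "edge_nbhd_degree G v = (\<Sum>e \<in> {e \<in> edges G. v \<in> e}. edge_degree G e)"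

definition min_edge_nbhd_degree :: "'a pair_pre_digraph \<Rightarrow> real" where
  "min_edge_nbhd_degree G = Min (edge_nbhd_degree G ` pverts G)"

definition max_edge_nbhd_degree :: "'a pair_pre_digraph \<Rightarrow> real" where
  "max_edge_nbhd_degree G = Max (edge_nbhd_degree G ` pverts G)"

definition first_Zagreb :: "'a pair_pre_digraph \<Rightarrow> nat" where
  "first_Zagreb G = (\<Sum>u \<in> pverts G. (vertex_degree G u)\<^sup>2)"

definition Kulli_Basava :: "real \<Rightarrow> 'a pair_pre_digraph \<Rightarrow> real" where
  "Kulli_Basava a G = (\<Sum>v \<in> pverts G. edge_nbhd_degree G v powr a)"

definition mult_Kulli_Basava :: "real \<Rightarrow> 'a pair_pre_digraph \<Rightarrow> real" where
  "mult_Kulli_Basava a G = (\<Prod>v \<in> pverts G. edge_nbhd_degree G v powr a)"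

end

theory Submission
  imports Defs "HOL-Analysis.Convex"
begin

text \<open>
  All three estimates are one chord inequality. If \<open>f\<close> is convex on the positive reals and the
  numbers \<open>S\<^sub>e(v)\<close> all lie in \<open>[\<delta>, \<Delta>]\<close> with \<open>\<delta> > 0\<close>, then the graph of \<open>f\<close> lies below its
  chord over \<open>[\<delta>, \<Delta>]\<close>, so
  \<open>f(S\<^sub>e(v)) \<le> f(\<delta>) + (S\<^sub>e(v) - \<delta>) (f(\<Delta>) - f(\<delta>)) / (\<Delta> - \<delta>)\<close>. The right-hand side is affine
  in \<open>S\<^sub>e(v)\<close>; hence its sum over all vertices sees the graph only through \<open>n\<close> and through
  \<open>\<Sum>\<^sub>v S\<^sub>e(v)\<close>. Since graph and chord meet at the two end points, equality holds
  when every \<open>S\<^sub>e(v)\<close> is an end point.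

  Parts (1) and (2) take for \<open>f\<close> the power function \<open>x \<mapsto> x\<^sup>a\<close>, which is convex
  for \<open>a < 0\<close> or \<open>a > 1\<close> and concave, so that the inequality is reversed, for \<open>0 < a < 1\<close>;
  part (3) takes the concave function \<open>ln\<close>, the logarithm of the product being \<open>a\<close> times the sum of the logarithms.

  Two facts about graphs feed this. Double counting of the incidences between vertices and edges
  gives \<open>\<Sum>\<^sub>v S\<^sub>e(v) = 2 M\<^sub>1 - 4 m\<close> (\<open>sum_edge_nbhd_degree\<close>). And \<open>\<delta> > 0\<close>, without which
  neither negative powers nor logarithms would be under control, holds since a connected graph has no isolated
  vertex among several, and since an edge of degree zero would be a connected component on its
  own, which \<open>n \<ge> 3\<close> excludes (\<open>edge_nbhd_degree_pos\<close>).
\<close>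

section \<open>Chord bounds for sums\<close>

lemma powr_convex_nonpos:
  fixes p :: real
  assumes "p \<le> 0"
  shows "convex_on {0<..} (\<lambda>x. x powr p)"
proof (rule f''_ge0_imp_convex)
  fix x :: real assume "x \<in> {0<..}"
  then show "((\<lambda>x. x powr p) has_real_derivative p * x powr (p - 1)) (at x)"
    and "((\<lambda>x. p * x powr (p - 1)) has_real_derivative p * ((p - 1) * x powr (p - 1 - 1))) (at x)"
    by (auto intro!: derivative_eq_intros)
  show "0 \<le> p * ((p - 1) * x powr (p - 1 - 1))"
    using assms by (auto intro!: mult_nonpos_nonpos mult_nonpos_nonneg)
qed simp

lemma powr_concave:
  fixes p :: real
  assumes "0 \<le> p" "p \<le> 1"
  shows "concave_on {0<..} (\<lambda>x. x powr p)"
proof (rule f''_le0_imp_concave)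
  fix x :: real assume "x \<in> {0<..}"
  then show "((\<lambda>x. x powr p) has_real_derivative p * x powr (p - 1)) (at x)"
    and "((\<lambda>x. p * x powr (p - 1)) has_real_derivative p * ((p - 1) * x powr (p - 1 - 1))) (at x)"
    by (auto intro!: derivative_eq_intros)
  show "p * ((p - 1) * x powr (p - 1 - 1)) \<le> 0"
    using assms by (intro mult_nonneg_nonpos[OF _ mult_nonpos_nonneg]) auto
qed simp

text \<open>The chord is affine, so summing its values needs only the number and the sum of the points.\<close>

lemma sum_chord:
  fixes s :: "'v \<Rightarrow> real" and k x b :: real
  shows "(\<Sum>v\<in>V. k * (s v - x) + b) =
    card V * b + ((\<Sum>v\<in>V. s v) - card V * x) * k"
  by (simp add: sum.distrib sum_subtractf sum_distrib_left[symmetric])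

lemma convex_sum_le_chord:
  fixes f :: "real \<Rightarrow> real" and s :: "'v \<Rightarrow> real" and x y :: real
  assumes "convex_on {x..y} f" and "\<And>v. v \<in> V \<Longrightarrow> s v \<in> {x..y}"
  shows "(\<Sum>v\<in>V. f (s v)) \<le>
    card V * f x + ((\<Sum>v\<in>V. s v) - card V * x) * ((f y - f x) / (y - x))"
  using sum_mono[of V "\<lambda>v. f (s v)" "\<lambda>v. (f y - f x) / (y - x) * (s v - x) + f x"]
    convex_onD_Icc'[OF assms(1)] assms(2)
  by (simp only: sum_chord)

lemma concave_sum_ge_chord:
  fixes f :: "real \<Rightarrow> real" and s :: "'v \<Rightarrow> real" and x y :: real
  assumes "concave_on {x..y} f" and "\<And>v. v \<in> V \<Longrightarrow> s v \<in> {x..y}"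
  shows "(\<Sum>v\<in>V. f (s v)) \<ge>
    card V * f x + ((\<Sum>v\<in>V. s v) - card V * x) * ((f y - f x) / (y - x))"
proof -
  define k where "k = (f y - f x) / (y - x)"
  have slope: "- k = (- f y - - f x) / (y - x)"
    by (simp add: k_def minus_divide_left)
  have "(\<Sum>v\<in>V. - f (s v)) \<le> card V * - f x + ((\<Sum>v\<in>V. s v) - card V * x) * - k"
    unfolding slope using assms by (intro convex_sum_le_chord) (simp_all add: concave_on_def)
  then show ?thesis
    by (simp add: sum_negf k_def[symmetric])
qed

lemma sum_eq_chord:
  fixes f :: "real \<Rightarrow> real" and s :: "'v \<Rightarrow> real" and x y :: real
  assumes "x \<noteq> y" and "\<And>v. v \<in> V \<Longrightarrow> s v = x \<or> s v = y"
  shows "(\<Sum>v\<in>V. f (s v)) =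
    card V * f x + ((\<Sum>v\<in>V. s v) - card V * x) * ((f y - f x) / (y - x))"
proof -
  have "(\<Sum>v\<in>V. f (s v)) = (\<Sum>v\<in>V. (f y - f x) / (y - x) * (s v - x) + f x)"
    using assms by (intro sum.cong) (auto, force)
  then show ?thesis
    by (simp only: sum_chord)
qed

section \<open>The sum of the edge neighborhood degrees\<close>

context pair_graph
begin

lemma edges_eq: "edges G = {{u, v} |u v. (u, v) \<in> parcs G}"
  by (auto simp: edges_def)

lemma finite_edges: "finite (edges G)"
  by (simp add: edges_def pair_finite_arcs)

lemma edge_subset_verts: "e \<in> edges G \<Longrightarrow> e \<subseteq> pverts G"
  by (auto simp: edges_eq dest: in_arcsD1 in_arcsD2)

lemma card_edge: "e \<in> edges G \<Longrightarrow> card e = 2"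
  by (auto simp: edges_eq dest: no_loops')

text \<open>Both sides sum a weight over all incident pairs of a vertex and an edge.\<close>

lemma sum_incidences:
  fixes w :: "'a \<Rightarrow> 'a set \<Rightarrow> 'b :: comm_monoid_add"
  shows "(\<Sum>v\<in>pverts G. \<Sum>e\<in>{e \<in> edges G. v \<in> e}. w v e) = (\<Sum>e\<in>edges G. \<Sum>v\<in>e. w v e)"
proof -
  have "(\<Sum>v\<in>pverts G. \<Sum>e\<in>{e \<in> edges G. v \<in> e}. w v e) =
      (\<Sum>e\<in>edges G. \<Sum>v\<in>{v \<in> pverts G. v \<in> e}. w v e)"
    by (rule sum.swap_restrict[OF pair_finite_verts finite_edges])
  also have "\<dots> = (\<Sum>e\<in>edges G. \<Sum>v\<in>e. w v e)"
    using edge_subset_verts by (intro sum.cong) auto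
  finally show ?thesis .
qed

text \<open>
  A vertex \<open>u\<close> contributes its degree once for each edge at \<open>u\<close>, that is \<open>d(u)\<^sup>2\<close> in total.
\<close>

lemma sum_vertex_degree_edges:
  "(\<Sum>e\<in>edges G. \<Sum>u\<in>e. real (vertex_degree G u)) = real (first_Zagreb G)"
  by (simp add: sum_incidences[symmetric] first_Zagreb_def vertex_degree_def power2_eq_square)

text \<open>Each edge is incident to two vertices, so its degree is counted twice.\<close>

lemma sum_edge_nbhd_degree:
  "(\<Sum>v\<in>pverts G. edge_nbhd_degree G v) = 2 * real (first_Zagreb G) - 4 * real (card (edges G))"
proof -
  have "(\<Sum>v\<in>pverts G. edge_nbhd_degree G v) = (\<Sum>e\<in>edges G. \<Sum>v\<in>e. edge_degree G e)"
    by (simp only: edge_nbhd_degree_def sum_incidences)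
  also have "\<dots> = (\<Sum>e\<in>edges G. 2 * (\<Sum>u\<in>e. real (vertex_degree G u)) - 4)"
    by (intro sum.cong) (simp_all add: card_edge edge_degree_def)
  also have "\<dots> = 2 * real (first_Zagreb G) - 4 * real (card (edges G))"
    by (simp add: sum_subtractf sum_distrib_left[symmetric] sum_vertex_degree_edges)
  finally show ?thesis .
qed

section \<open>Positivity of the edge neighborhood degrees\<close>

lemma connected_arc_leaving:
  assumes "Digraph_Component.connected (with_proj G)"
    and "x \<in> S" "x \<in> pverts G" "y \<in> pverts G" "y \<notin> S"
  obtains u v where "(u, v) \<in> parcs G" "u \<in> S" "v \<notin> S"
proof -
  have "x \<rightarrow>\<^sup>*\<^bsub>with_proj (mk_symmetric (with_proj G))\<^esub> y"
    using assms by (simp add: Digraph_Component.connected_def strongly_connected_def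
        mk_symmetric_def)
  then have "x \<rightarrow>\<^sup>*\<^bsub>with_proj G\<^esub> y"
    using reachable_mk_symmetric_eq pair_sym_arcs by simp
  then have "y \<in> S" if "\<And>u v. (u, v) \<in> parcs G \<Longrightarrow> u \<in> S \<Longrightarrow> v \<in> S"
    by (induction rule: reachable_induct) (use that \<open>x \<in> S\<close> in auto)
  with \<open>y \<notin> S\<close> that show thesis by blast
qed

lemma vertex_degree_pos:
  assumes "e \<in> edges G" "u \<in> e"
  shows "vertex_degree G u \<ge> 1"
proof -
  have "card {e} \<le> vertex_degree G u"
    unfolding vertex_degree_def using assms by (intro card_mono) (auto simp: finite_edges)
  then show ?thesis by simp
qed

lemma vertex_degree_ge_2:
  assumes "e \<in> edges G" "e' \<in> edges G" "e \<noteq> e'" "u \<in> e" "u \<in> e'"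
  shows "vertex_degree G u \<ge> 2"
proof -
  have "card {e, e'} \<le> vertex_degree G u"
    unfolding vertex_degree_def using assms by (intro card_mono) (auto simp: finite_edges)
  with \<open>e \<noteq> e'\<close> show ?thesis by simp
qed

lemma edge_degree_nonneg:
  assumes "e \<in> edges G"
  shows "edge_degree G e \<ge> 0"
proof -
  have "(\<Sum>u\<in>e. (1::real)) \<le> (\<Sum>u\<in>e. real (vertex_degree G u))"
    using vertex_degree_pos[OF assms] by (intro sum_mono) (simp add: Suc_le_eq)
  then show ?thesis
    by (simp add: edge_degree_def card_edge[OF assms])
qed

text \<open>
  Connectedness provides an edge \<open>uv\<close> leaving \<open>{v}\<close> and, as there is a third vertex, another edge
  leaving \<open>{u, v}\<close>. So one end of \<open>uv\<close> has degree at least 2 and the edge \<open>uv\<close> contributes at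
  least 1 to the sum at \<open>v\<close>; no other edge contributes a negative amount.
\<close>

lemma edge_nbhd_degree_pos:
  assumes conn: "Digraph_Component.connected (with_proj G)"
    and three: "card (pverts G) \<ge> 3" and v: "v \<in> pverts G"
  shows "edge_nbhd_degree G v > 0"
proof -
  have other: "\<exists>y\<in>pverts G. y \<notin> S" if "finite S" "card S \<le> 2" for S
    using that three card_mono[of S "pverts G"] by force
  obtain y where "y \<in> pverts G" "y \<notin> {v}"
    using other[of "{v}"] by auto
  then obtain u where vu: "(v, u) \<in> parcs G" "u \<noteq> v"
    using connected_arc_leaving[OF conn, of v "{v}" y] v by auto
  have "card {v, u} \<le> 2"
    by (simp add: card_insert_if)
  then obtain z where "z \<in> pverts G" "z \<notin> {v, u}"
    using other[of "{v, u}"] by auto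
  then obtain x w where xw: "(x, w) \<in> parcs G" "x \<in> {v, u}" "w \<notin> {v, u}"
    using connected_arc_leaving[OF conn, of v "{v, u}" z] v by auto
  have e: "{v, u} \<in> edges G" and e': "{x, w} \<in> edges G"
    using vu xw by (auto simp: edges_eq)
  have "vertex_degree G x \<ge> 2"
    using xw by (intro vertex_degree_ge_2[OF e e']) auto
  moreover have "vertex_degree G v \<ge> 1" "vertex_degree G u \<ge> 1"
    by (rule vertex_degree_pos[OF e], simp)+
  ultimately have "edge_degree G {v, u} > 0"
    using vu xw(2) by (auto simp: edge_degree_def)
  then show ?thesis
    unfolding edge_nbhd_degree_def
    using e edge_degree_nonneg by (intro sum_pos2[of _ "{v, u}"]) (auto simp: finite_edges)
qed

end

section \<open>Bounds for the Kulli-Basava indices\<close>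

theorem corollary3p4:
  fixes G :: "'a pair_pre_digraph"
    and n m :: nat
    and \<delta> \<Delta> M\<^sub>1 a s\<^sub>a :: real
  assumes "pair_graph G" and "Digraph_Component.connected (with_proj G)"
    and "n = card (pverts G)" and "n \<ge> 3" and "m = card (edges G)"
    and "\<delta> = min_edge_nbhd_degree G" and "\<Delta> = max_edge_nbhd_degree G" and "\<delta> \<noteq> \<Delta>"
    and "M\<^sub>1 = real (first_Zagreb G)"
    and "a \<noteq> 0" and "a \<noteq> 1"
    and "s\<^sub>a = (\<Delta> powr a - \<delta> powr a) / (\<Delta> - \<delta>)"
  shows
    "(a < 0 \<or> a > 1 \<longrightarrow>
        Kulli_Basava a G \<le> n * \<delta> powr a + (2 * M\<^sub>1 - 4 * m - n * \<delta>) * s\<^sub>a \<and>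
        ((\<forall>v \<in> pverts G. edge_nbhd_degree G v = \<delta> \<or> edge_nbhd_degree G v = \<Delta>) \<longrightarrow>
          Kulli_Basava a G = n * \<delta> powr a + (2 * M\<^sub>1 - 4 * m - n * \<delta>) * s\<^sub>a)) \<and>
     (0 < a \<and> a < 1 \<longrightarrow>
        Kulli_Basava a G \<ge> n * \<delta> powr a + (2 * M\<^sub>1 - 4 * m - n * \<delta>) * s\<^sub>a \<and>
        ((\<forall>v \<in> pverts G. edge_nbhd_degree G v = \<delta> \<or> edge_nbhd_degree G v = \<Delta>) \<longrightarrow>
          Kulli_Basava a G = n * \<delta> powr a + (2 * M\<^sub>1 - 4 * m - n * \<delta>) * s\<^sub>a)) \<and>
     (a > 1 \<longrightarrow>
        ln (mult_Kulli_Basava a G) \<ge>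
          a * (n * ln \<delta> + (2 * M\<^sub>1 - 4 * m - n * \<delta>) * (ln \<Delta> - ln \<delta>) / (\<Delta> - \<delta>)) \<and>
        ((\<forall>v \<in> pverts G. edge_nbhd_degree G v = \<delta> \<or> edge_nbhd_degree G v = \<Delta>) \<longrightarrow>
          ln (mult_Kulli_Basava a G) =
          a * (n * ln \<delta> + (2 * M\<^sub>1 - 4 * m - n * \<delta>) * (ln \<Delta> - ln \<delta>) / (\<Delta> - \<delta>))))"
proof -
  interpret pair_graph G by fact
  define s where "s = edge_nbhd_degree G"
  define V where "V = pverts G"
  have fin: "finite V"
    by (simp add: V_def pair_finite_verts)
  have "V \<noteq> {}"
    using \<open>n = card (pverts G)\<close> \<open>n \<ge> 3\<close> by (auto simp: V_def)
  have pos: "s v > 0" if "v \<in> V" for v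
    using that assms edge_nbhd_degree_pos by (simp add: s_def V_def)
  have range: "s v \<in> {\<delta>..\<Delta>}" if "v \<in> V" for v
    using that fin assms(6,7)
    by (simp add: min_edge_nbhd_degree_def max_edge_nbhd_degree_def s_def V_def)
  have "\<delta> \<in> s ` V"
    using fin \<open>V \<noteq> {}\<close> assms(6) Min_in[of "s ` V"]
    by (simp add: min_edge_nbhd_degree_def s_def V_def)
  with pos have "\<delta> > 0" by auto
  then have sub: "{\<delta>..\<Delta>} \<subseteq> {0<..}" by auto
  have total: "(\<Sum>v\<in>V. s v) = 2 * M\<^sub>1 - 4 * m"
    using assms sum_edge_nbhd_degree by (simp add: s_def V_def)
  have n: "n = card V"
    using assms by (simp add: V_def)

  have KB: "Kulli_Basava a G = (\<Sum>v\<in>V. s v powr a)"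
    by (simp add: Kulli_Basava_def s_def V_def)
  have ln_KB: "ln (mult_Kulli_Basava a G) = a * (\<Sum>v\<in>V. ln (s v))"
  proof -
    have "ln (mult_Kulli_Basava a G) = (\<Sum>v\<in>V. ln (s v powr a))"
      unfolding mult_Kulli_Basava_def s_def[symmetric] V_def[symmetric]
      using fin by (intro ln_prod) (auto dest: pos)
    also have "\<dots> = a * (\<Sum>v\<in>V. ln (s v))"
      using pos by (simp add: sum_distrib_left ln_powr)
    finally show ?thesis .
  qed

  have "Kulli_Basava a G \<le> n * \<delta> powr a + (2 * M\<^sub>1 - 4 * m - n * \<delta>) * s\<^sub>a"
    if "a < 0 \<or> a > 1"
  proof -
    have "convex_on {0<..} (\<lambda>x. x powr a)"
      using that by (auto intro: powr_convex powr_convex_nonpos)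
    then have "convex_on {\<delta>..\<Delta>} (\<lambda>x. x powr a)"
      using sub by (rule convex_on_subset) simp
    from convex_sum_le_chord[where s = s and V = V, OF this range] show ?thesis
      by (simp add: KB total n assms(12))
  qed
  moreover have "Kulli_Basava a G \<ge> n * \<delta> powr a + (2 * M\<^sub>1 - 4 * m - n * \<delta>) * s\<^sub>a"
    if "0 < a \<and> a < 1"
  proof -
    have "concave_on {0<..} (\<lambda>x. x powr a)"
      using that by (auto intro: powr_concave)
    then have "concave_on {\<delta>..\<Delta>} (\<lambda>x. x powr a)"
      using sub unfolding concave_on_def by (rule convex_on_subset) simp
    from concave_sum_ge_chord[where s = s and V = V, OF this range] show ?thesis
      by (simp add: KB total n assms(12))
  qed
  moreover have "Kulli_Basava a G = n * \<delta> powr a + (2 * M\<^sub>1 - 4 * m - n * \<delta>) * s\<^sub>a"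
    if "\<forall>v \<in> pverts G. edge_nbhd_degree G v = \<delta> \<or> edge_nbhd_degree G v = \<Delta>"
    using sum_eq_chord[of \<delta> \<Delta> V s "\<lambda>x. x powr a"] that[folded s_def V_def] \<open>\<delta> \<noteq> \<Delta>\<close>
    by (simp add: KB total n assms(12))
  moreover have "ln (mult_Kulli_Basava a G) \<ge>
      a * (n * ln \<delta> + (2 * M\<^sub>1 - 4 * m - n * \<delta>) * (ln \<Delta> - ln \<delta>) / (\<Delta> - \<delta>))"
    if "a > 1"
  proof -
    have "concave_on {\<delta>..\<Delta>} ln"
      using ln_concave sub unfolding concave_on_def by (rule convex_on_subset) simp
    from concave_sum_ge_chord[where s = s and V = V, OF this range] that show ?thesis
      by (simp add: ln_KB total n)
  qed
  moreover have "ln (mult_Kulli_Basava a G) =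
      a * (n * ln \<delta> + (2 * M\<^sub>1 - 4 * m - n * \<delta>) * (ln \<Delta> - ln \<delta>) / (\<Delta> - \<delta>))"
    if "\<forall>v \<in> pverts G. edge_nbhd_degree G v = \<delta> \<or> edge_nbhd_degree G v = \<Delta>"
    using sum_eq_chord[of \<delta> \<Delta> V s ln] that[folded s_def V_def] \<open>\<delta> \<noteq> \<Delta>\<close>
    by (simp add: ln_KB total n)
  ultimately show ?thesis
    by blast
qed

end
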